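(* For a typical map $f\in\mathcal C[0,1]$ there exists an uncountable set $\mathcal F$ of fixed points of $f$ such that for each $x\in\mathcal F$ the Dirac delta measure $\delta_x$ is a pseudo-physical measure for $f$.
   Context: $\mathcal C[0,1]$ is the space of continuous maps of $[0,1]$ to itself, with the uniform metric. A property is typical ("holds for a typical map") if there is a dense $G_\delta$ subset $G\subset\mathcal C[0,1]$ such that all $f\in G$ have the property. "Measure" means Borel probability measure on $[0,1]$. Fix a countable dense subset $\{\Psi_i\}_{i\in\mathbb N}$ of $\mathcal C[0,1]$ and let $\mathrm{dist}(\mu,\nu)=\sum_{i\ge1}2^{-i}\left|\int\Psi_i\,d\mu-\int\Psi_i\,d\nu\right|$, which induces the weak$^*$ topology. For $x\in[0,1]$, $p\omega(x)$ is the set of weak$^*$ limits of convergent subsequences of $\frac1n\sum_{j=0}^{n-1}\delta_{f^j(x)}$, and $\mathrm{dist}(p\omega(x),\mu)=\inf_{\nu\in p\omega(x)}\mathrm{dist}(\nu,\mu)$. A measure $\mu$ is pseudo-physical for $f$ if for every $\varepsilon>0$ the set $\{x\in[0,1]:\mathrm{dist}(p\omega(x),\mu)<\varepsilon\}$ has positive Lebesgue measure. *)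

theory Defs
  imports "HOL-Probability.Probability"
begin

text \<open>The self-maps of the unit interval are represented by functions that are
  \<^const>\<open>undefined\<close> outside it, as usual for \<^const>\<open>cfunspace\<close>; the two lemmas
  below spell out the carrier and the metric.\<close>

definition C01 :: "(real \<Rightarrow> real) metric" where
  "C01 = cfunspace (top_of_set {0..1}) (submetric euclidean_metric {0..1})"

lemma mspace_C01:
  "mspace C01 = {f \<in> extensional {0..1}. continuous_on {0..1} f \<and> f ` {0..1} \<subseteq> {0..1}}"
proof -
  have "compactin (top_of_set {0..1::real}) (topspace (top_of_set {0..1}))"
    by (simp add: compactin_subtopology)
  then show ?thesis
    by (auto simp: C01_def compactin_mspace_cfunspace mtopology_of_submetric
        continuous_map_in_subtopology simp del: mspace_cfunspace)
qed

lemma mdist_C01: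
  assumes "f \<in> mspace C01" "g \<in> mspace C01"
  shows "mdist C01 f g = (SUP x\<in>{0..1}. \<bar>f x - g x\<bar>)"
proof -
  interpret M: Metric_space "{0..1::real}" dist
    by (simp add: Met_TC.subspace)
  have "f \<in> M.fspace {0..1}" "g \<in> M.fspace {0..1}"
    using assms by (auto simp: C01_def M.fspace_def)
  then show ?thesis
    by (simp add: C01_def mdist_cfunspace_eq_mdist_funspace M.fdist_def dist_real_def)
qed

definition typically :: "'a topology \<Rightarrow> ('a \<Rightarrow> bool) \<Rightarrow> bool" where
  "typically X P \<longleftrightarrow>
     (\<exists>G. gdelta_in X G \<and> X closure_of G = topspace X \<and> (\<forall>f\<in>G. P f))"

abbreviation borel01 :: "real measure" where
  "borel01 \<equiv> restrict_space borel {0..1}"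

definition measures01 :: "real measure set" where
  "measures01 = {\<mu>. prob_space \<mu> \<and> sets \<mu> = sets borel01}"

definition dirac :: "real \<Rightarrow> real measure" where
  "dirac x = return borel01 x"

text \<open>Convergence is tested on all continuous functions. The members of \<open>M\<close> and \<open>\<mu>\<close> are meant to
  live on \<^term>\<open>borel01\<close>, so values of \<open>\<phi>\<close> outside the unit interval do not matter.\<close>

definition weak_star_conv :: "(nat \<Rightarrow> real measure) \<Rightarrow> real measure \<Rightarrow> bool" where
  "weak_star_conv M \<mu> \<longleftrightarrow>
     (\<forall>\<phi>::real \<Rightarrow> real. continuous_on {0..1} \<phi> \<longrightarrow>
        (\<lambda>n. integral\<^sup>L (M n) \<phi>) \<longlonglongrightarrow> integral\<^sup>L \<mu> \<phi>)"

text \<open>The average of the Dirac measures along the first \<open>n\<close> points of the orbit, as the image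
  of the uniform probability on the times \<open>0, \<dots>, n - 1\<close>; see \<open>emeasure_empirical\<close> below.\<close>

definition empirical :: "(real \<Rightarrow> real) \<Rightarrow> nat \<Rightarrow> real \<Rightarrow> real measure" where
  "empirical f n x = distr (uniform_count_measure {..<n}) borel01 (\<lambda>j. (f ^^ j) x)"

lemma funpow_mem_01:
  fixes f :: "real \<Rightarrow> real"
  assumes "f ` {0..1} \<subseteq> {0..1}" "x \<in> {0..1}"
  shows "(f ^^ j) x \<in> {0..1}"
proof (induction j)
  case (Suc j)
  then show ?case
    using assms(1) by (simp only: funpow.simps o_apply) blast
qed (use assms in simp)

lemma emeasure_empirical:
  assumes "f ` {0..1} \<subseteq> {0..1}" "x \<in> {0..1}" "A \<in> sets borel01" "n > 0"
  shows "emeasure (empirical f n x) A = (\<Sum>j<n. emeasure (dirac ((f ^^ j) x)) A) / n"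
proof -
  have meas: "(\<lambda>j. (f ^^ j) x) \<in> uniform_count_measure {..<n} \<rightarrow>\<^sub>M borel01"
    using funpow_mem_01[OF assms(1,2)]
    by (auto simp: measurable_def space_uniform_count_measure sets_uniform_count_measure
        space_restrict_space)
  have "emeasure (uniform_count_measure {..<n}) {j. j < n \<and> (f ^^ j) x \<in> A}
      = card {j. j < n \<and> (f ^^ j) x \<in> A} / n"
    by (subst emeasure_uniform_count_measure) auto
  then have "emeasure (empirical f n x) A = card {j. j < n \<and> (f ^^ j) x \<in> A} / n"
    using assms(3)
    by (subst empirical_def, subst emeasure_distr[OF meas])
       (auto simp: space_uniform_count_measure vimage_def Int_def conj_commute)
  also have "\<dots> = of_nat (card {j. j < n \<and> (f ^^ j) x \<in> A}) / of_nat n"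
    using assms(4) by (simp add: ennreal_of_nat_eq_real_of_nat divide_ennreal)
  also have "of_nat (card {j. j < n \<and> (f ^^ j) x \<in> A})
      = (\<Sum>j<n. emeasure (dirac ((f ^^ j) x)) A)"
    using assms(3)
    by (simp add: dirac_def indicator_def sum.If_cases Int_def)
  finally show ?thesis .
qed

text \<open>The averages are indexed by \<open>n \<ge> 1\<close>, hence the successor.\<close>

definition p_omega :: "(real \<Rightarrow> real) \<Rightarrow> real \<Rightarrow> real measure set" where
  "p_omega f x = {\<nu> \<in> measures01.
     \<exists>r. strict_mono r \<and> weak_star_conv (\<lambda>k. empirical f (Suc (r k)) x) \<nu>}"

text \<open>The dense sequence is indexed from \<open>0\<close> here, so the weights \<open>2\<^sup>-\<^sup>i\<close>, \<open>i \<ge> 1\<close>, are shifted.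
  The series converges since every \<open>\<Psi> i\<close> takes values in the unit interval.\<close>

definition mu_dist :: "(nat \<Rightarrow> real \<Rightarrow> real) \<Rightarrow> real measure \<Rightarrow> real measure \<Rightarrow> real" where
  "mu_dist \<Psi> \<mu> \<nu> =
     (\<Sum>i. (1/2) ^ Suc i * \<bar>integral\<^sup>L \<mu> (\<Psi> i) - integral\<^sup>L \<nu> (\<Psi> i)\<bar>)"

text \<open>The infimum is over a nonempty set, by weak-star compactness of the probability measures on
  the unit interval, and is bounded below by \<open>0\<close>. A set outside the Lebesgue sigma-algebra has
  \<^const>\<open>emeasure\<close> \<open>0\<close>, so positivity includes measurability.\<close>

definition pseudo_physical ::
  "(nat \<Rightarrow> real \<Rightarrow> real) \<Rightarrow> (real \<Rightarrow> real) \<Rightarrow> real measure \<Rightarrow> bool" where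
  "pseudo_physical \<Psi> f \<mu> \<longleftrightarrow> \<mu> \<in> measures01 \<and>
     (\<forall>\<epsilon>>0. emeasure lebesgue
        {x \<in> {0..1}. (INF \<nu>\<in>p_omega f x. mu_dist \<Psi> \<nu> \<mu>) < \<epsilon>} > 0)"

end

theory Submission
  imports Defs
begin

text \<open>Call an interval \<open>[a, b]\<close> invariant if \<open>f\<close> maps it into itself. An orbit that starts in a
  short invariant interval never leaves it, so all its empirical measures, and hence all elements
  of \<open>p\<omega>\<close>, are close to \<open>\<delta>\<^sub>x\<close> for every \<open>x\<close> in that interval. As an interval has positive
  length, a point \<open>x\<close> that lies in arbitrarily short invariant intervals is a fixed point whose
  Dirac measure is pseudo-physical (\<open>dirac_pseudo_physical\<close>). It remains to see that a typical map
  has uncountably many such points.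

  Every invariant interval contains a fixed point, and there the graph can be bent by an
  arbitrarily small perturbation so that two disjoint short intervals nearby are mapped into their
  own interiors (\<open>splitting_perturbation\<close>). Being mapped into the interior survives small changes
  of the map, and having a given interval invariant is a closed condition. So, for fixed \<open>a\<close>, \<open>b\<close>
  and \<open>\<delta>\<close>, the maps for which \<open>[a, b]\<close>, if invariant, contains two disjoint invariant intervals
  shorter than \<open>\<delta>\<close> include a dense open set. By the Baire category theorem a typical map has this
  property for all rational \<open>a\<close>, \<open>b\<close> and all \<open>\<delta> = 1, 1/2, 1/3, \<dots>\<close> at once. For such a map,
  and any sequence \<open>e\<close> of points, invariant intervals that shrink to a point can be nested in such
  a way that each of them avoids the next \<open>e n\<close>, since of two disjoint intervals one always does.
  Hence the good points cannot be enumerated (\<open>uncountable_shrinking_points\<close>).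

  Positive outer measure is not enough: the set of starting points in the definition of
  pseudo-physical measures also has to be measurable. Weak-star compactness turns the infimum over
  \<open>p\<omega>\<close> into a condition on the distances of the empirical measures themselves, which are Borel
  functions of the starting point (\<open>dist_p_omega_less_iff\<close>, \<open>dist_p_omega_measurable\<close>).\<close>

section \<open>Measures on the unit interval and the distance between them\<close>

lemma C01_D:
  assumes "f \<in> mspace C01"
  shows "continuous_on {0..1} f" and "x \<in> {0..1} \<Longrightarrow> f x \<in> {0..1}"
  using assms unfolding mspace_C01 by blast+

lemma borel_measurable_borel01:
  fixes \<phi> :: "real \<Rightarrow> real"
  shows "continuous_on {0..1} \<phi> \<Longrightarrow> \<phi> \<in> borel_measurable borel01"
  by (rule borel_measurable_continuous_on_restrict)

lemma integral_in_interval: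
  fixes \<phi> :: "real \<Rightarrow> real"
  assumes \<mu>: "\<mu> \<in> measures01" and cont: "continuous_on {0..1} \<phi>"
    and bnd: "\<And>x. x \<in> {0..1} \<Longrightarrow> \<phi> x \<in> {l..u}"
  shows "integral\<^sup>L \<mu> \<phi> \<in> {l..u}"
proof -
  interpret prob_space \<mu> using \<mu> by (simp add: measures01_def)
  have sets: "sets \<mu> = sets borel01" using \<mu> by (simp add: measures01_def)
  have sp: "space \<mu> = {0..1}"
    using sets_eq_imp_space_eq[OF sets] by (simp add: space_restrict_space)
  have meas: "\<phi> \<in> borel_measurable \<mu>"
    using borel_measurable_borel01[OF cont] sets measurable_cong_sets by blast
  have "AE x in \<mu>. norm (\<phi> x) \<le> max \<bar>l\<bar> \<bar>u\<bar>"
    using bnd by (intro AE_I2) (fastforce simp: sp)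
  then have int: "integrable \<mu> \<phi>"
    using meas by (rule integrable_const_bound)
  show ?thesis
    using bnd integral_ge_const[OF int AE_I2, of l] integral_le_const[OF int AE_I2, of u]
    by (simp add: sp)
qed

lemma dirac_in_measures01: "x \<in> {0..1} \<Longrightarrow> dirac x \<in> measures01"
  by (auto simp: measures01_def dirac_def space_restrict_space intro!: prob_space_return)

lemma integral_dirac:
  fixes \<phi> :: "real \<Rightarrow> real"
  assumes "x \<in> {0..1}" "continuous_on {0..1} \<phi>"
  shows "integral\<^sup>L (dirac x) \<phi> = \<phi> x"
  using assms borel_measurable_borel01[OF assms(2)]
  by (simp add: dirac_def integral_return space_restrict_space)

lemma orbit_measurable:
  assumes "f \<in> mspace C01" "x \<in> {0..1}"
  shows "(\<lambda>j. (f ^^ j) x) \<in> uniform_count_measure {..<n} \<rightarrow>\<^sub>M borel01"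
proof -
  have "f ` {0..1} \<subseteq> {0..1}" using C01_D(2)[OF assms(1)] by blast
  then show ?thesis
    using funpow_mem_01[OF _ assms(2)]
    by (auto simp: measurable_def space_uniform_count_measure sets_uniform_count_measure
        space_restrict_space)
qed

lemma empirical_in_measures01:
  assumes "f \<in> mspace C01" "x \<in> {0..1}" "n > 0"
  shows "empirical f n x \<in> measures01"
proof -
  interpret prob_space "uniform_count_measure {..<n}"
    using assms(3) by (intro prob_space_uniform_count_measure) auto
  show ?thesis
    using prob_space_distr[OF orbit_measurable[OF assms(1,2)]]
    by (simp add: measures01_def empirical_def)
qed

lemma integral_empirical:
  fixes \<phi> :: "real \<Rightarrow> real"
  assumes "f \<in> mspace C01" "x \<in> {0..1}" "continuous_on {0..1} \<phi>"
  shows "integral\<^sup>L (empirical f n x) \<phi> = (\<Sum>j<n. \<phi> ((f ^^ j) x)) / n"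
  unfolding empirical_def
  by (subst integral_distr[OF orbit_measurable[OF assms(1,2)] borel_measurable_borel01[OF assms(3)]])
     (simp add: integral_uniform_count_measure)

lemma mu_dist_term_bound:
  assumes \<Psi>: "range \<Psi> \<subseteq> mspace C01" and "\<mu> \<in> measures01" "\<nu> \<in> measures01"
  shows "\<bar>integral\<^sup>L \<mu> (\<Psi> i) - integral\<^sup>L \<nu> (\<Psi> i)\<bar> \<le> 1"
proof -
  have "integral\<^sup>L \<rho> (\<Psi> i) \<in> {0..1}" if "\<rho> \<in> measures01" for \<rho>
    using \<Psi> C01_D[of "\<Psi> i"] by (intro integral_in_interval[OF that]) auto
  from this[OF assms(2)] this[OF assms(3)] show ?thesis by auto
qed

lemma summable_geometric_half: "summable (\<lambda>i. (1/2::real) ^ Suc i)"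
  using power_half_series by (rule sums_summable)

lemma mu_dist_summable:
  assumes "range \<Psi> \<subseteq> mspace C01" "\<mu> \<in> measures01" "\<nu> \<in> measures01"
  shows "summable (\<lambda>i. (1/2) ^ Suc i * \<bar>integral\<^sup>L \<mu> (\<Psi> i) - integral\<^sup>L \<nu> (\<Psi> i)\<bar>)"
  using mu_dist_term_bound[OF assms]
  by (intro summable_comparison_test'[OF summable_geometric_half, of 0])
     (simp add: abs_mult mult_left_le)

lemma mu_dist_nonneg:
  assumes "range \<Psi> \<subseteq> mspace C01" "\<mu> \<in> measures01" "\<nu> \<in> measures01"
  shows "mu_dist \<Psi> \<mu> \<nu> \<ge> 0"
  unfolding mu_dist_def by (intro suminf_nonneg mu_dist_summable[OF assms]) auto

text \<open>The weights sum to \<open>1\<close> and those from index \<open>N\<close> on to \<open>2\<^sup>-\<^sup>N\<close>, where each term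
  is at most its weight. So closeness on finitely many test functions controls the whole distance.\<close>

lemma mu_dist_le_head_tail:
  assumes "range \<Psi> \<subseteq> mspace C01" "\<mu> \<in> measures01" "\<nu> \<in> measures01"
    and close: "\<And>i. i < N \<Longrightarrow> \<bar>integral\<^sup>L \<mu> (\<Psi> i) - integral\<^sup>L \<nu> (\<Psi> i)\<bar> \<le> \<delta>"
    and "\<delta> \<ge> 0"
  shows "mu_dist \<Psi> \<mu> \<nu> \<le> \<delta> + (1/2) ^ N"
proof -
  let ?t = "\<lambda>i. (1/2) ^ Suc i * \<bar>integral\<^sup>L \<mu> (\<Psi> i) - integral\<^sup>L \<nu> (\<Psi> i)\<bar>"
  note summ = mu_dist_summable[OF assms(1-3)]
  have geo: "(\<Sum>i. (1/2::real) ^ Suc i) = 1"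
    using power_half_series by (rule sums_unique[symmetric])
  have "(\<Sum>i<N. ?t i) \<le> (\<Sum>i<N. (1/2) ^ Suc i * \<delta>)"
    using close by (intro sum_mono mult_left_mono) auto
  also have "\<dots> = (\<Sum>i<N. (1/2) ^ Suc i) * \<delta>"
    by (rule sum_distrib_right[symmetric])
  also have "\<dots> \<le> (\<Sum>i. (1/2::real) ^ Suc i) * \<delta>"
    using \<open>\<delta> \<ge> 0\<close> by (intro mult_right_mono sum_le_suminf summable_geometric_half) auto
  finally have head: "(\<Sum>i<N. ?t i) \<le> \<delta>" by (simp only: geo)
  have summ': "summable (\<lambda>i. (1/2::real) ^ Suc i * (1/2) ^ N)"
    by (rule summable_mult2[OF summable_geometric_half])
  have "(\<Sum>i. ?t (i + N)) \<le> (\<Sum>i. (1/2) ^ Suc i * (1/2) ^ N)"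
    using mu_dist_term_bound[OF assms(1-3)]
    by (intro suminf_le summ' summable_ignore_initial_segment[OF summ])
       (simp add: power_add mult_left_le)
  also have "\<dots> = (1/2) ^ N"
    by (subst suminf_mult2[OF summable_geometric_half, symmetric]) (simp only: geo mult_1)
  finally show ?thesis
    using head suminf_split_initial_segment[OF summ, of N] by (simp add: mu_dist_def)
qed

text \<open>Each term of the series converges, and the geometric weights dominate the terms uniformly
  in \<open>n\<close>, so that limit and sum may be exchanged.\<close>

lemma mu_dist_weak_star_continuous:
  assumes "range \<Psi> \<subseteq> mspace C01" "\<And>n. M n \<in> measures01" "\<nu> \<in> measures01"
    and conv: "weak_star_conv M \<mu>"
  shows "(\<lambda>n. mu_dist \<Psi> (M n) \<nu>) \<longlonglongrightarrow> mu_dist \<Psi> \<mu> \<nu>"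
proof -
  have "(\<lambda>n. integral\<^sup>L (M n) (\<Psi> i)) \<longlonglongrightarrow> integral\<^sup>L \<mu> (\<Psi> i)" for i
    using conv assms(1) C01_D(1)[of "\<Psi> i"] by (auto simp: weak_star_conv_def)
  then have lim: "(\<lambda>n. (1/2) ^ Suc i * \<bar>integral\<^sup>L (M n) (\<Psi> i) - integral\<^sup>L \<nu> (\<Psi> i)\<bar>)
      \<longlonglongrightarrow> (1/2) ^ Suc i * \<bar>integral\<^sup>L \<mu> (\<Psi> i) - integral\<^sup>L \<nu> (\<Psi> i)\<bar>" for i
    by (intro tendsto_intros)
  have bound: "norm ((1/2) ^ Suc i * \<bar>integral\<^sup>L (M n) (\<Psi> i) - integral\<^sup>L \<nu> (\<Psi> i)\<bar>)
      \<le> (1/2) ^ Suc i" for i n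
    using mu_dist_term_bound[OF assms(1) assms(2)[of n] assms(3)]
    by (simp add: abs_mult mult_left_le)
  show ?thesis
    unfolding mu_dist_def
    using tannerys_theorem[OF lim _ summable_geometric_half sequentially_bot] bound
    by (simp add: always_eventually case_prod_beta)
qed

section \<open>Weak-star compactness and measurability\<close>

text \<open>The retraction of the line onto the unit interval extends test functions from the interval
  to the line, carries measures on the line back to the interval, and serves as a cut-off in the
  perturbation of maps below.\<close>

definition clamp01 :: "real \<Rightarrow> real" where
  "clamp01 x = max 0 (min 1 x)"

lemma clamp01_props:
  "clamp01 x \<in> {0..1}" "x \<in> {0..1} \<Longrightarrow> clamp01 x = x" "continuous_on A clamp01"
  unfolding clamp01_def by (auto intro!: continuous_intros)

lemma clamp01_measurable: "sets M = sets borel \<Longrightarrow> clamp01 \<in> M \<rightarrow>\<^sub>M borel01"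
  using clamp01_props(1) borel_measurable_continuous_onI[OF clamp01_props(3)]
  by (subst measurable_cong_sets[OF _ refl, of _ borel])
     (auto intro!: measurable_restrict_space2)

text \<open>Regarded as distributions on the line, the measures form a tight sequence, so Helly's
  selection theorem yields a limit \<open>R\<close> along a subsequence. Pushing \<open>R\<close> forward by the retraction
  gives a measure on the unit interval, and testing it against \<open>\<phi>\<close> amounts to testing \<open>R\<close> against
  the bounded continuous function \<open>\<phi> \<circ> clamp01\<close>.\<close>

lemma measures01_weak_star_compact:
  assumes M: "\<And>n. M n \<in> measures01"
  shows "\<exists>r \<nu>. strict_mono (r :: nat \<Rightarrow> nat) \<and> \<nu> \<in> measures01 \<and> weak_star_conv (M \<circ> r) \<nu>"
proof -
  define N where "N n = distr (M n) borel (\<lambda>x. x)" for n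
  have id_meas: "(\<lambda>x. x) \<in> M n \<rightarrow>\<^sub>M borel" for n
    using M[of n] borel_measurable_borel01[of "\<lambda>x. x"] measurable_cong_sets[of "M n" borel01]
    by (auto simp: measures01_def)
  have sp: "space (M n) = {0..1}" for n
    using M[of n] sets_eq_imp_space_eq[of "M n" borel01]
    by (auto simp: measures01_def space_restrict_space)
  have P: "prob_space (M n)" for n using M[of n] by (simp add: measures01_def)
  have rd: "real_distribution (N n)" for n
    unfolding N_def using prob_space.real_distribution_distr[OF P id_meas] .
  \<comment> \<open>Tightness is stated with half-open intervals, which must include the point \<open>0\<close>.\<close>
  have "measure (N n) {-1<..1} = 1" for n
  proof -
    have "measure (N n) {-1<..1} = measure (M n) (space (M n))"
      unfolding N_def by (subst measure_distr[OF id_meas]) (auto simp: sp intro!: arg_cong[where f = "measure (M n)"])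
    then show ?thesis using prob_space.prob_space[OF P] by simp
  qed
  then have "tight N"
    unfolding tight_def using rd by (intro conjI allI impI exI[of _ "-1"] exI[of _ 1]) auto
  from tight_imp_convergent_subsubsequence[OF this strict_mono_id]
  obtain r R where r: "strict_mono r" and R: "real_distribution R"
    and conv: "weak_conv_m (N \<circ> id \<circ> r) R" by blast
  interpret R: real_distribution R by fact
  have cR: "clamp01 \<in> R \<rightarrow>\<^sub>M borel01" by (rule clamp01_measurable) simp
  define \<nu> where "\<nu> = distr R borel01 clamp01"
  have "\<nu> \<in> measures01"
    using R.prob_space_distr[OF cR] by (simp add: measures01_def \<nu>_def)
  moreover have "weak_star_conv (M \<circ> r) \<nu>"
    unfolding weak_star_conv_def
  proof (intro allI impI)
    fix \<phi> :: "real \<Rightarrow> real" assume \<phi>: "continuous_on {0..1} \<phi>"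
    let ?g = "\<lambda>x. \<phi> (clamp01 x)"
    have g: "continuous_on UNIV ?g"
      using clamp01_props(1)
      by (intro continuous_on_compose2[OF \<phi> clamp01_props(3)]) auto
    obtain B where B: "\<And>x. x \<in> {0..1} \<Longrightarrow> norm (\<phi> x) \<le> B"
      using compact_imp_bounded[OF compact_continuous_image[OF \<phi> compact_Icc]]
      unfolding bounded_iff by blast
    have "(\<lambda>n. integral\<^sup>L ((N \<circ> id \<circ> r) n) ?g) \<longlonglongrightarrow> integral\<^sup>L R ?g"
      using g B[OF clamp01_props(1)] rd conv R
      by (intro weak_conv_imp_integral_bdd_continuous_conv[where B = B])
         (auto simp: continuous_on_eq_continuous_at o_def)
    moreover have "integral\<^sup>L ((N \<circ> id \<circ> r) n) ?g = integral\<^sup>L ((M \<circ> r) n) \<phi>" for n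
    proof -
      have "integral\<^sup>L ((N \<circ> id \<circ> r) n) ?g = integral\<^sup>L (M (r n)) ?g"
        using borel_measurable_continuous_onI[OF g]
        by (simp add: N_def integral_distr[OF id_meas])
      also have "\<dots> = integral\<^sup>L (M (r n)) \<phi>"
        by (rule Bochner_Integration.integral_cong) (auto simp: sp clamp01_props(2))
      finally show ?thesis by simp
    qed
    moreover have "integral\<^sup>L \<nu> \<phi> = integral\<^sup>L R ?g"
      unfolding \<nu>_def by (rule integral_distr[OF cR borel_measurable_borel01[OF \<phi>]])
    ultimately show "(\<lambda>n. integral\<^sup>L ((M \<circ> r) n) \<phi>) \<longlonglongrightarrow> integral\<^sup>L \<nu> \<phi>" by simp
  qed
  ultimately show ?thesis using r by blast
qed

lemma p_omega_of_subsequence: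
  assumes "f \<in> mspace C01" "y \<in> {0..1}" and s: "strict_mono (s :: nat \<Rightarrow> nat)"
  obtains \<nu> r where "strict_mono r" "\<nu> \<in> p_omega f y"
    "weak_star_conv (\<lambda>k. empirical f (Suc (s (r k))) y) \<nu>"
proof -
  obtain r :: "nat \<Rightarrow> nat" and \<nu> where r: "strict_mono r" "\<nu> \<in> measures01"
    and conv: "weak_star_conv ((\<lambda>k. empirical f (Suc (s k)) y) \<circ> r) \<nu>"
    using measures01_weak_star_compact[of "\<lambda>k. empirical f (Suc (s k)) y"]
      empirical_in_measures01[OF assms(1,2)] by blast
  have "strict_mono (s \<circ> r)" using s r by (simp add: strict_mono_o)
  with r conv have "\<nu> \<in> p_omega f y"
    by (auto simp: p_omega_def o_def intro!: exI[of _ "s \<circ> r"])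
  with r conv show ?thesis by (intro that) (auto simp: o_def)
qed

text \<open>The infimum is the lower limit of the distances of the empirical measures to \<open>\<mu>\<close>: the
  distance is weak-star continuous, and by compactness infinitely many empirical measures always
  accumulate at an element of \<open>p\<omega>\<close>. The margin \<open>1 / Suc k\<close> keeps the inequality strict in the
  limit. The right-hand side uses only countable quantifiers.\<close>

lemma dist_p_omega_less_iff:
  assumes \<Psi>: "range \<Psi> \<subseteq> mspace C01" and f: "f \<in> mspace C01" and y: "y \<in> {0..1}"
    and \<mu>: "\<mu> \<in> measures01"
  shows "(INF \<nu>\<in>p_omega f y. mu_dist \<Psi> \<nu> \<mu>) < \<epsilon> \<longleftrightarrow>
    (\<exists>k. \<forall>m. \<exists>n\<ge>m. mu_dist \<Psi> (empirical f (Suc n) y) \<mu> < \<epsilon> - 1 / Suc k)"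
    (is "?I < \<epsilon> \<longleftrightarrow> ?R")
proof
  let ?D = "\<lambda>n. mu_dist \<Psi> (empirical f (Suc n) y) \<mu>"
  have emp: "empirical f (Suc n) y \<in> measures01" for n
    by (rule empirical_in_measures01[OF f y]) simp
  have ne: "p_omega f y \<noteq> {}"
    using p_omega_of_subsequence[OF f y strict_mono_id] by blast
  {
    assume "?I < \<epsilon>"
    then obtain \<nu> where \<nu>: "\<nu> \<in> p_omega f y" "mu_dist \<Psi> \<nu> \<mu> < \<epsilon>"
      using cInf_lessD[of "(\<lambda>\<nu>. mu_dist \<Psi> \<nu> \<mu>) ` p_omega f y"] ne by auto
    obtain k where k: "1 / Suc k < \<epsilon> - mu_dist \<Psi> \<nu> \<mu>"
      using \<nu>(2) nat_approx_posE[of "\<epsilon> - mu_dist \<Psi> \<nu> \<mu>"] by auto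
    obtain r where r: "strict_mono r" "weak_star_conv (\<lambda>k. empirical f (Suc (r k)) y) \<nu>"
      using \<nu>(1) by (auto simp: p_omega_def)
    have "(\<lambda>j. ?D (r j)) \<longlonglongrightarrow> mu_dist \<Psi> \<nu> \<mu>"
      by (rule mu_dist_weak_star_continuous[OF \<Psi> emp \<mu> r(2)])
    then have "\<forall>\<^sub>F j in sequentially. ?D (r j) < \<epsilon> - 1 / Suc k"
      by (rule order_tendstoD) (use k in simp)
    then obtain J where J: "\<And>j. j \<ge> J \<Longrightarrow> ?D (r j) < \<epsilon> - 1 / Suc k"
      by (auto simp: eventually_sequentially)
    have "\<exists>n\<ge>m. ?D n < \<epsilon> - 1 / Suc k" for m
      using J[of "max J m"] seq_suble[OF r(1), of "max J m"]
      by (intro exI[of _ "r (max J m)"]) auto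
    then show ?R by blast
  next
    assume ?R
    then obtain k where k: "\<And>m. \<exists>n\<ge>m. ?D n < \<epsilon> - 1 / Suc k" by blast
    then have "infinite {n. ?D n < \<epsilon> - 1 / Suc k}"
      by (simp add: infinite_nat_iff_unbounded_le)
    then obtain s :: "nat \<Rightarrow> nat" where s: "strict_mono s" "\<And>n. ?D (s n) < \<epsilon> - 1 / Suc k"
      using infinite_enumerate[of "{n. ?D n < \<epsilon> - 1 / Suc k}"] by auto
    obtain \<nu> r where \<nu>: "\<nu> \<in> p_omega f y"
      and conv: "weak_star_conv (\<lambda>k. empirical f (Suc (s (r k))) y) \<nu>"
      using p_omega_of_subsequence[OF f y s(1)] by blast
    have "(\<lambda>j. ?D (s (r j))) \<longlonglongrightarrow> mu_dist \<Psi> \<nu> \<mu>"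
      by (rule mu_dist_weak_star_continuous[OF \<Psi> emp \<mu> conv])
    then have "mu_dist \<Psi> \<nu> \<mu> \<le> \<epsilon> - 1 / Suc k"
      by (rule LIMSEQ_le_const2) (use s(2) less_imp_le in blast)
    moreover have "?I \<le> mu_dist \<Psi> \<nu> \<mu>"
      using mu_dist_nonneg[OF \<Psi> _ \<mu>]
      by (intro cINF_lower \<nu> bdd_belowI2[of _ 0]) (auto simp: p_omega_def)
    ultimately show "?I < \<epsilon>"
      by (smt (verit) of_nat_0_less_iff zero_less_Suc zero_less_divide_1_iff)
  }
qed

lemma dist_p_omega_measurable:
  assumes \<Psi>: "range \<Psi> \<subseteq> mspace C01" and f: "f \<in> mspace C01" and \<mu>: "\<mu> \<in> measures01"
  shows "{y \<in> {0..1}. (INF \<nu>\<in>p_omega f y. mu_dist \<Psi> \<nu> \<mu>) < \<epsilon>} \<in> sets borel"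
proof -
  let ?D = "\<lambda>n y. mu_dist \<Psi> (empirical f (Suc n) y) \<mu>"
  have \<Psi>': "continuous_on {0..1} (\<Psi> i)" for i
    using \<Psi> C01_D(1)[of "\<Psi> i"] by auto
  have iter: "continuous_on {0..1} (f ^^ j)" for j
  proof (induction j)
    case (Suc j)
    have "(f ^^ j) ` {0..1} \<subseteq> {0..1}"
      using funpow_mem_01[of f] C01_D(2)[OF f] by blast
    then show ?case
      using continuous_on_compose2[OF C01_D(1)[OF f] Suc] by (simp add: o_def)
  qed (simp add: id_def)
  have iter': "(\<lambda>y. \<Psi> i ((f ^^ j) y)) \<in> borel_measurable borel01" for i j
    using funpow_mem_01[of f] C01_D(2)[OF f]
    by (intro borel_measurable_borel01 continuous_on_compose2[OF \<Psi>' iter]) blast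
  have [measurable]: "?D n \<in> borel_measurable borel01" for n
  proof (subst measurable_cong)
    show "?D n y = (\<Sum>i. (1/2) ^ Suc i *
        \<bar>(\<Sum>j<Suc n. \<Psi> i ((f ^^ j) y)) / real (Suc n) - integral\<^sup>L \<mu> (\<Psi> i)\<bar>)"
      if "y \<in> space borel01" for y
      using that integral_empirical[OF f _ \<Psi>']
      by (simp add: mu_dist_def space_restrict_space del: sum.lessThan_Suc of_nat_Suc)
  qed (use iter' in measurable)
  have "{y \<in> space borel01. \<exists>k. \<forall>m. \<exists>n\<ge>m. ?D n y < \<epsilon> - 1 / Suc k} \<in> sets borel01"
    by measurable
  also have "{y \<in> space borel01. \<exists>k. \<forall>m. \<exists>n\<ge>m. ?D n y < \<epsilon> - 1 / Suc k}
      = {y \<in> {0..1}. (INF \<nu>\<in>p_omega f y. mu_dist \<Psi> \<nu> \<mu>) < \<epsilon>}"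
    using dist_p_omega_less_iff[OF \<Psi> f _ \<mu>] by (auto simp: space_restrict_space)
  finally show ?thesis
    by (simp add: sets_restrict_space_iff)
qed

section \<open>Fixed points inside arbitrarily short invariant intervals\<close>

definition invariant_interval :: "(real \<Rightarrow> real) \<Rightarrow> real \<Rightarrow> real \<Rightarrow> bool" where
  "invariant_interval f a b \<longleftrightarrow> 0 \<le> a \<and> a < b \<and> b \<le> 1 \<and> f ` {a..b} \<subseteq> {a..b}"

text \<open>The length \<open>b - a\<close> tends to \<open>0\<close>, which makes such a point fixed, while each single interval is
  nondegenerate, which makes the set of starting points with nearby empirical measures have
  positive length.\<close>

definition shrinking_points :: "(real \<Rightarrow> real) \<Rightarrow> real set" where
  "shrinking_points f = {x. \<forall>\<delta>>0. \<exists>a b. x \<in> {a..b} \<and> b - a < \<delta> \<and> invariant_interval f a b}"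

lemma invariant_interval_funpow:
  assumes "invariant_interval f a b" "y \<in> {a..b}"
  shows "(f ^^ j) y \<in> {a..b}"
proof (induction j)
  case (Suc j)
  then show ?case
    using assms(1) by (simp only: invariant_interval_def funpow.simps o_apply) blast
qed (use assms(2) in simp)

lemma shrinking_pointE:
  assumes "x \<in> shrinking_points f" "\<delta> > 0"
  obtains a b where "x \<in> {a..b}" "b - a < \<delta>" "invariant_interval f a b"
  using assms unfolding shrinking_points_def by blast

lemma shrinking_point_fixed:
  assumes "x \<in> shrinking_points f"
  shows "x \<in> {0..1}" "f x = x"
proof -
  show "x \<in> {0..1}"
    by (rule shrinking_pointE[OF assms zero_less_one]) (auto simp: invariant_interval_def)
  show "f x = x"
  proof (rule ccontr)
    assume "f x \<noteq> x"
    then have "\<bar>f x - x\<bar> > 0" by simp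
    then obtain a b where ab: "x \<in> {a..b}" "b - a < \<bar>f x - x\<bar>" "invariant_interval f a b"
      by (rule shrinking_pointE[OF assms])
    then have "f x \<in> {a..b}" unfolding invariant_interval_def by blast
    then show False using ab(1,2) by auto
  qed
qed

lemma average_near:
  fixes a :: "nat \<Rightarrow> real"
  assumes "n > 0" and near: "\<And>j. \<bar>a j - c\<bar> \<le> \<delta>"
  shows "\<bar>(\<Sum>j<n. a j) / n - c\<bar> \<le> \<delta>"
proof -
  have "\<bar>\<Sum>j<n. a j - c\<bar> \<le> (\<Sum>j<n. \<delta>)"
    using near by (intro order_trans[OF sum_abs sum_mono])
  moreover have "(\<Sum>j<n. a j - c) = n * ((\<Sum>j<n. a j) / n - c)"
    using \<open>n > 0\<close> by (simp add: sum_subtractf right_diff_distrib)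
  ultimately show ?thesis using \<open>n > 0\<close> by (simp add: abs_mult)
qed

text \<open>Orbits starting in an invariant interval around \<open>x\<close> stay in it. If the interval is so short
  that the first \<open>N\<close> test functions vary little there, all empirical measures of such orbits are
  close to \<open>\<delta>\<^sub>x\<close>, so the set in question contains the whole interval.\<close>

lemma dirac_pseudo_physical:
  assumes \<Psi>: "range \<Psi> \<subseteq> mspace C01" and f: "f \<in> mspace C01" and x: "x \<in> shrinking_points f"
  shows "pseudo_physical \<Psi> f (dirac x)"
  unfolding pseudo_physical_def
proof (intro conjI allI impI)
  note x01 = shrinking_point_fixed(1)[OF x]
  note dx = dirac_in_measures01[OF x01]
  show "dirac x \<in> measures01" by fact
  fix \<epsilon> :: real assume "\<epsilon> > 0"
  let ?A = "{y \<in> {0..1}. (INF \<nu>\<in>p_omega f y. mu_dist \<Psi> \<nu> (dirac x)) < \<epsilon>}"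
  have \<Psi>': "continuous_on {0..1} (\<Psi> i)" for i
    using \<Psi> C01_D(1)[of "\<Psi> i"] by auto
  obtain N where N: "(1/2::real) ^ N < \<epsilon> / 4"
    using real_arch_pow_inv[of "\<epsilon> / 4" "1/2"] \<open>\<epsilon> > 0\<close> by auto
  have "\<forall>i. \<exists>\<delta>>0. \<forall>z\<in>{0..1}. dist z x < \<delta> \<longrightarrow> dist (\<Psi> i z) (\<Psi> i x) < \<epsilon> / 4"
  proof
    fix i
    show "\<exists>\<delta>>0. \<forall>z\<in>{0..1}. dist z x < \<delta> \<longrightarrow> dist (\<Psi> i z) (\<Psi> i x) < \<epsilon> / 4"
      using \<Psi>'[of i, unfolded continuous_on_iff, rule_format, OF x01, of "\<epsilon> / 4"] \<open>\<epsilon> > 0\<close>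
      by simp
  qed
  then obtain d where d: "\<And>i. d i > 0"
    "\<And>i z. z \<in> {0..1} \<Longrightarrow> dist z x < d i \<Longrightarrow> dist (\<Psi> i z) (\<Psi> i x) < \<epsilon> / 4"
    by metis
  define \<delta> where "\<delta> = Min (insert 1 (d ` {..<N}))"
  have "\<delta> > 0" using d(1) by (auto simp: \<delta>_def)
  have \<delta>: "dist (\<Psi> i z) (\<Psi> i x) < \<epsilon> / 4" if "i < N" "z \<in> {0..1}" "dist z x < \<delta>" for i z
  proof -
    have "\<delta> \<le> d i" using that(1) by (auto simp: \<delta>_def)
    then show ?thesis using d(2)[OF that(2), of i] that(3) by simp
  qed
  obtain a b where xab: "x \<in> {a..b}" "b - a < \<delta>" and inv: "invariant_interval f a b"
    by (rule shrinking_pointE[OF x \<open>\<delta> > 0\<close>])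
  have ab: "0 \<le> a" "a < b" "b \<le> 1" using inv by (auto simp: invariant_interval_def)
  have close: "mu_dist \<Psi> (empirical f (Suc n) y) (dirac x) < \<epsilon> - \<epsilon> / 4" if y: "y \<in> {a..b}" for y n
  proof -
    have y01: "y \<in> {0..1}" using y ab by auto
    have "\<bar>integral\<^sup>L (empirical f (Suc n) y) (\<Psi> i) - integral\<^sup>L (dirac x) (\<Psi> i)\<bar> \<le> \<epsilon> / 4"
      if "i < N" for i
    proof -
      have "\<bar>\<Psi> i ((f ^^ j) y) - \<Psi> i x\<bar> \<le> \<epsilon> / 4" for j
      proof -
        have "(f ^^ j) y \<in> {a..b}" by (rule invariant_interval_funpow[OF inv y])
        then have "(f ^^ j) y \<in> {0..1}" "dist ((f ^^ j) y) x < \<delta>"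
          using xab ab by (auto simp: dist_real_def)
        from \<delta>[OF that this] show ?thesis by (simp add: dist_real_def)
      qed
      then have "\<bar>(\<Sum>j<Suc n. \<Psi> i ((f ^^ j) y)) / Suc n - \<Psi> i x\<bar> \<le> \<epsilon> / 4"
        by (rule average_near[OF zero_less_Suc])
      then show ?thesis
        by (simp add: integral_empirical[OF f y01 \<Psi>'] integral_dirac[OF x01 \<Psi>']
            del: sum.lessThan_Suc of_nat_Suc)
    qed
    then have "mu_dist \<Psi> (empirical f (Suc n) y) (dirac x) \<le> \<epsilon> / 4 + (1/2) ^ N"
      using \<open>\<epsilon> > 0\<close> empirical_in_measures01[OF f y01]
      by (intro mu_dist_le_head_tail[OF \<Psi> _ dx]) auto
    then show ?thesis using N \<open>\<epsilon> > 0\<close> by simp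
  qed
  obtain k where "1 / Suc k < \<epsilon> / 4"
    using \<open>\<epsilon> > 0\<close> nat_approx_posE[of "\<epsilon> / 4"] by auto
  then have "\<exists>k. \<forall>m. \<exists>n\<ge>m. mu_dist \<Psi> (empirical f (Suc n) y) (dirac x) < \<epsilon> - 1 / Suc k"
    if "y \<in> {a..b}" for y
    using close[OF that] by (intro exI[of _ k]) (smt (verit) order_refl)
  then have "{a..b} \<subseteq> ?A"
    using ab by (auto simp: dist_p_omega_less_iff[OF \<Psi> f _ dx])
  then have "emeasure lebesgue {a..b} \<le> emeasure lebesgue ?A"
    using dist_p_omega_measurable[OF \<Psi> f dx] by (intro emeasure_mono) auto
  moreover have "emeasure lebesgue {a..b} > 0" using ab by simp
  ultimately show "emeasure lebesgue ?A > 0" by (rule less_le_trans[rotated])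
qed

text \<open>The two intervals are mapped into their interiors, rather than just into themselves, so that
  the property is stable under small perturbations. Their endpoints are rational so that they are
  again among the countably many intervals for which splitting is demanded.\<close>

definition splits :: "(real \<Rightarrow> real) \<Rightarrow> real \<Rightarrow> real \<Rightarrow> real \<Rightarrow> bool" where
  "splits f a b \<delta> \<longleftrightarrow> (\<exists>c d c' d'. {c, d, c', d'} \<subseteq> \<rat> \<and>
     a \<le> c \<and> c < d \<and> d < c' \<and> c' < d' \<and> d' \<le> b \<and> d - c < \<delta> \<and> d' - c' < \<delta> \<and>
     f ` {c..d} \<subseteq> {c<..<d} \<and> f ` {c'..d'} \<subseteq> {c'<..<d'})"

lemma splits_avoiding:
  assumes "splits f a b \<delta>" "0 \<le> a" "b \<le> 1"
  shows "\<exists>c d. c \<in> \<rat> \<and> d \<in> \<rat> \<and> a \<le> c \<and> d \<le> b \<and> d - c < \<delta> \<and> z \<notin> {c..d} \<and> invariant_interval f c d"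
proof -
  obtain c d c' d' where *: "{c, d, c', d'} \<subseteq> \<rat>"
    "a \<le> c" "c < d" "d < c'" "c' < d'" "d' \<le> b" "d - c < \<delta>" "d' - c' < \<delta>"
    "f ` {c..d} \<subseteq> {c<..<d}" "f ` {c'..d'} \<subseteq> {c'<..<d'}"
    using assms(1) unfolding splits_def by (elim exE conjE) (rule that)
  have sub: "{c<..<d} \<subseteq> {c..d}" "{c'<..<d'} \<subseteq> {c'..d'}" by auto
  have inv: "invariant_interval f c d" "invariant_interval f c' d'"
    using * assms(2,3) order_trans[OF *(9) sub(1)] order_trans[OF *(10) sub(2)]
    by (auto simp: invariant_interval_def)
  show ?thesis
  proof (cases "z \<in> {c..d}")
    case True
    then show ?thesis using * inv by (intro exI[of _ c'] exI[of _ d']) auto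
  next
    case False
    then show ?thesis using * inv by (intro exI[of _ c] exI[of _ d]) auto
  qed
qed

text \<open>A diagonal argument: against any enumeration \<open>e\<close>, choose nested invariant intervals, the
  \<open>n + 1\<close>st of length less than \<open>1 / (n + 1)\<close> and without \<open>e n\<close>. Their common point is missed
  by \<open>e\<close>.\<close>

lemma uncountable_shrinking_points:
  assumes f: "f \<in> mspace C01"
    and splits: "\<And>a b n. a \<in> \<rat> \<Longrightarrow> b \<in> \<rat> \<Longrightarrow> invariant_interval f a b \<Longrightarrow> splits f a b (1 / Suc n)"
  shows "uncountable (shrinking_points f)"
proof
  assume cnt: "countable (shrinking_points f)"
  define e where "e = from_nat_into (shrinking_points f)"
  define P where "P n p \<longleftrightarrow> fst p \<in> \<rat> \<and> snd p \<in> \<rat> \<and> invariant_interval f (fst p) (snd p) \<and>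
    (\<forall>m. n = Suc m \<longrightarrow> snd p - fst p < 1 / Suc m \<and> e m \<notin> {fst p..snd p})" for n p
  \<comment> \<open>The whole unit interval is invariant under every map, which starts the construction.\<close>
  have "P 0 (0, 1)"
    using C01_D(2)[OF f] by (auto simp: P_def invariant_interval_def)
  moreover have "\<exists>q. P (Suc n) q \<and> (fst p \<le> fst q \<and> snd q \<le> snd p)" if "P n p" for n p
  proof -
    have "splits f (fst p) (snd p) (1 / Suc n)"
      using that by (intro splits) (auto simp: P_def)
    from splits_avoiding[OF this, of "e n"] that show ?thesis
      by (auto simp: P_def invariant_interval_def)
  qed
  ultimately obtain p where p: "\<And>n. P n (p n)"
    and nest: "\<And>n. fst (p n) \<le> fst (p (Suc n)) \<and> snd (p (Suc n)) \<le> snd (p n)"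
    using dependent_nat_choice[of P "\<lambda>_ p q. fst p \<le> fst q \<and> snd q \<le> snd p"] by blast
  have "\<exists>x. \<forall>n. x \<in> {fst (p n)..snd (p n)}"
  proof -
    have inc: "incseq (\<lambda>n. fst (p n))" and dec: "decseq (\<lambda>n. snd (p n))"
      using nest by (auto intro: incseq_SucI decseq_SucI)
    have le: "fst (p m) \<le> snd (p n)" for m n
    proof -
      have "fst (p m) \<le> fst (p (max m n))" using inc by (auto simp: incseq_def)
      also have "\<dots> \<le> snd (p (max m n))" using p[of "max m n"] by (auto simp: P_def invariant_interval_def)
      also have "\<dots> \<le> snd (p n)" using dec by (auto simp: decseq_def)
      finally show ?thesis .
    qed
    have "bdd_above (range (\<lambda>n. fst (p n)))" using le by (auto intro!: bdd_aboveI2)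
    then show ?thesis
      using le by (intro exI[of _ "SUP n. fst (p n)"]) (auto intro: cSUP_upper cSUP_least)
  qed
  then obtain x where x: "\<And>n. x \<in> {fst (p n)..snd (p n)}" by blast
  have "x \<in> shrinking_points f"
    unfolding shrinking_points_def
  proof (intro CollectI allI impI)
    fix \<delta> :: real assume "\<delta> > 0"
    then obtain n where "1 / Suc n < \<delta>" using nat_approx_posE by blast
    then have "snd (p (Suc n)) - fst (p (Suc n)) < \<delta>" using p[of "Suc n"] by (auto simp: P_def)
    with x[of "Suc n"] p[of "Suc n"]
    show "\<exists>a b. x \<in> {a..b} \<and> b - a < \<delta> \<and> invariant_interval f a b"
      unfolding P_def by blast
  qed
  then obtain n where "x = e n"
    using from_nat_into_surj[OF cnt] by (auto simp: e_def)
  then show False using x[of "Suc n"] p[of "Suc n"] by (auto simp: P_def)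
qed

section \<open>Splitting is generic\<close>

interpretation C01: Metric_space "mspace C01" "mdist C01"
  by (rule Metric_space_mspace_mdist)

lemma dist_le_mdist_C01:
  assumes "f \<in> mspace C01" "g \<in> mspace C01" "x \<in> {0..1}"
  shows "\<bar>f x - g x\<bar> \<le> mdist C01 f g"
proof -
  have "bdd_above ((\<lambda>x. \<bar>f x - g x\<bar>) ` {0..1})"
    using C01_D(2)[OF assms(1)] C01_D(2)[OF assms(2)]
    by (intro bdd_aboveI2[where M = 1]) fastforce
  then show ?thesis
    unfolding mdist_C01[OF assms(1,2)] using assms(3) by (intro cSUP_upper)
qed

text \<open>A compact image inside \<open>V\<close> keeps a positive distance from the complement of \<open>V\<close>. Taking
  \<open>K\<close> to be an interval gives stability of strictly invariant intervals; taking \<open>K\<close> to be a point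
  gives stability of the failure of invariance.\<close>

lemma openin_image_subset:
  assumes K: "compact K" "K \<subseteq> {0..1}" and V: "open V"
  shows "openin C01.mtopology {f \<in> mspace C01. f ` K \<subseteq> V}"
  unfolding C01.openin_mtopology
proof (intro conjI allI impI)
  fix f assume "f \<in> {f \<in> mspace C01. f ` K \<subseteq> V}"
  then have f: "f \<in> mspace C01" and fK: "f ` K \<subseteq> V" by auto
  have "compact (f ` K)"
    using compact_continuous_image continuous_on_subset[OF C01_D(1)[OF f] K(2)] K(1) by blast
  then obtain r where r: "r > 0" "(\<Union>x\<in>f ` K. ball x r) \<subseteq> V"
    using compact_subset_open_imp_ball_epsilon_subset[OF _ V fK] by blast
  have "g x \<in> V" if "g \<in> C01.mball f r" "x \<in> K" for g x
  proof -
    have "dist (f x) (g x) < r"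
      using that dist_le_mdist_C01[of f g x] K(2) by (auto simp: dist_real_def)
    then show ?thesis using r(2) that(2) by (auto simp: subset_iff)
  qed
  then have "C01.mball f r \<subseteq> {f \<in> mspace C01. f ` K \<subseteq> V}" by auto
  then show "\<exists>r>0. C01.mball f r \<subseteq> {f \<in> mspace C01. f ` K \<subseteq> V}" using r(1) by blast
qed auto

definition splitting_maps :: "real \<Rightarrow> real \<Rightarrow> real \<Rightarrow> (real \<Rightarrow> real) set" where
  "splitting_maps a b \<delta> = {f \<in> mspace C01. invariant_interval f a b \<longrightarrow> splits f a b \<delta>}"

text \<open>Failure of invariance is open, and so is splitting, as a union over the possible endpoints of
  the two intervals.\<close>

lemma openin_splitting_maps: "openin C01.mtopology (splitting_maps a b \<delta>)"
proof (cases "0 \<le> a \<and> a < b \<and> b \<le> 1")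
  case ab: True
  have "openin C01.mtopology {f \<in> mspace C01. \<not> f ` {a..b} \<subseteq> {a..b}}"
  proof -
    have "{f \<in> mspace C01. \<not> f ` {a..b} \<subseteq> {a..b}}
        = (\<Union>x\<in>{a..b}. {f \<in> mspace C01. f ` {x} \<subseteq> - {a..b}})" by auto
    also have "openin C01.mtopology \<dots>"
      using ab by (intro openin_Union ballI) (auto simp del: image_insert intro!: openin_image_subset)
    finally show ?thesis .
  qed
  moreover have "openin C01.mtopology {f \<in> mspace C01. splits f a b \<delta>}"
  proof -
    let ?Q = "{(c, d, c', d'). {c, d, c', d'} \<subseteq> \<rat> \<and> a \<le> c \<and> c < d \<and> d < c' \<and> c' < d' \<and> d' \<le> b \<and>
      d - c < \<delta> \<and> d' - c' < \<delta>}"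
    let ?T = "\<lambda>c d. {f \<in> mspace C01. f ` {c..d} \<subseteq> {c<..<d}}"
    have "{f \<in> mspace C01. splits f a b \<delta>} = (\<Union>(c, d, c', d')\<in>?Q. ?T c d \<inter> ?T c' d')"
      unfolding splits_def by blast
    then show ?thesis
      using ab by (auto intro!: openin_Union openin_Int openin_image_subset)
  qed
  moreover have "splitting_maps a b \<delta> = {f \<in> mspace C01. \<not> f ` {a..b} \<subseteq> {a..b}} \<union> {f \<in> mspace C01. splits f a b \<delta>}"
    using ab by (auto simp: splitting_maps_def invariant_interval_def)
  ultimately show ?thesis by (simp add: openin_Un)
next
  case False
  then have "splitting_maps a b \<delta> = topspace C01.mtopology"
    by (auto simp: splitting_maps_def invariant_interval_def)
  then show ?thesis by (metis openin_topspace)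
qed

lemma fixed_point_in_invariant_interval:
  assumes "f \<in> mspace C01" and inv: "invariant_interval f a b"
  obtains p where "p \<in> {a..b}" "f p = p"
proof -
  have "continuous_on {a..b} f"
    using inv C01_D(1)[OF assms(1)] continuous_on_subset by (fastforce simp: invariant_interval_def)
  moreover have "f \<in> {a..b} \<rightarrow> {a..b}" "a \<le> b" using inv by (auto simp: invariant_interval_def)
  ultimately show ?thesis
    using brouwer[of "{a..b}" f] that by auto
qed

text \<open>Near a fixed point \<open>p\<close> both \<open>f x\<close> and \<open>x\<close> are close to \<open>p\<close>, so \<open>f\<close> may be replaced there, at
  little cost, by any continuous \<open>k\<close> with values close to \<open>p\<close>. The function \<open>k\<close> takes the constant
  value \<open>m\<close> on an interval around \<open>m\<close>, and \<open>m'\<close> on a second one around \<open>m'\<close>. The weight \<open>w\<close>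
  interpolates between \<open>k\<close> near \<open>p\<close> and \<open>f\<close> away from \<open>p\<close>; as a convex combination the result
  stays in the unit interval.\<close>

lemma splitting_perturbation:
  assumes f: "f \<in> mspace C01" and inv: "invariant_interval f a b" and "\<delta> > 0" and "r > 0"
  obtains g where "g \<in> mspace C01" "splits g a b \<delta>" "mdist C01 f g \<le> r"
proof -
  have ab: "0 \<le> a" "a < b" "b \<le> 1" using inv by (auto simp: invariant_interval_def)
  obtain p where p: "p \<in> {a..b}" "f p = p"
    using fixed_point_in_invariant_interval[OF f inv] .
  have p01: "p \<in> {0..1}" using p(1) ab by auto
  then obtain h where h: "h > 0" "\<And>x. x \<in> {0..1} \<Longrightarrow> dist x p < h \<Longrightarrow> dist (f x) (f p) < r / 2"
    using C01_D(1)[OF f] \<open>r > 0\<close> unfolding continuous_on_iff by (metis half_gt_zero)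
  define \<eta> where "\<eta> = min (h / 2) (min (r / 2) \<delta>)"
  have \<eta>: "\<eta> > 0" "2 * \<eta> \<le> h" "\<eta> \<le> r / 2" "\<eta> \<le> \<delta>"
    using h(1) \<open>\<delta> > 0\<close> \<open>r > 0\<close> by (auto simp: \<eta>_def)
  \<comment> \<open>The fixed point may be an endpoint of \<open>[a, b]\<close>, so the room for the two short intervals is
    the part of the neighbourhood of \<open>p\<close> inside \<open>[a, b]\<close>, possibly on one side of \<open>p\<close> only.\<close>
  define u where "u = max a (p - \<eta> / 2)"
  define v where "v = min b (p + \<eta> / 2)"
  have uv: "u < v" "a \<le> u" "v \<le> b" "p - \<eta> < u" "v < p + \<eta>"
    using p(1) ab \<eta>(1) by (auto simp: u_def v_def)
  have "v - u \<le> \<eta>" by (auto simp: u_def v_def)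
  obtain c where c: "c \<in> \<rat>" "u < c" "c < v" using Rats_dense_in_real[OF uv(1)] by blast
  obtain d where d: "d \<in> \<rat>" "c < d" "d < v" using Rats_dense_in_real[OF c(3)] by blast
  obtain c' where c': "c' \<in> \<rat>" "d < c'" "c' < v" using Rats_dense_in_real[OF d(3)] by blast
  obtain d' where d': "d' \<in> \<rat>" "c' < d'" "d' < v" using Rats_dense_in_real[OF c'(3)] by blast
  define m where "m = (c + d) / 2"
  define m' where "m' = (c' + d') / 2"
  have m: "c < m" "m < d" "c' < m'" "m' < d'" using d d' by (auto simp: m_def m'_def)
  define k where "k x = m + (m' - m) * clamp01 ((x - d) / (c' - d))" for x
  define w where "w x = clamp01 (2 - \<bar>x - p\<bar> / \<eta>)" for x
  define g where "g = restrict (\<lambda>x. f x + w x * (k x - f x)) {0..1}"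
  have k_lo: "k x = m" if "x \<le> d" for x
    using that c' by (simp add: k_def clamp01_def divide_nonpos_pos)
  have k_hi: "k x = m'" if "c' \<le> x" for x
  proof -
    have "(x - d) / (c' - d) \<ge> 1" using that c' by simp
    then show ?thesis by (simp add: k_def clamp01_def)
  qed
  have k_range: "k x \<in> {m..m'}" for x
  proof -
    have "0 \<le> (m' - m) * clamp01 t" "(m' - m) * clamp01 t \<le> m' - m" for t
      using clamp01_props(1)[of t] m d c' by (auto intro!: mult_left_le)
    from this[of "(x - d) / (c' - d)"] show ?thesis by (simp add: k_def)
  qed
  have k01: "k x \<in> {0..1}" for x
    using k_range[of x] m c d c' d' uv ab by auto
  have w01: "0 \<le> w x" "w x \<le> 1" for x using clamp01_props(1) by (auto simp: w_def)
  have w_near: "w x = 1" if "\<bar>x - p\<bar> \<le> \<eta>" for x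
    using that \<eta>(1) by (simp add: w_def clamp01_def divide_le_eq)
  have w_far: "w x = 0" if "\<bar>x - p\<bar> \<ge> 2 * \<eta>" for x
  proof -
    have "\<bar>x - p\<bar> / \<eta> \<ge> 2" using that \<eta>(1) by (simp add: le_divide_eq)
    then show ?thesis by (simp add: w_def clamp01_def)
  qed
  have g_cont: "continuous_on {0..1} g"
  proof -
    have "continuous_on {0..1} (\<lambda>x. f x + w x * (k x - f x))"
      unfolding w_def k_def using c' \<eta>(1) clamp01_props(3)
      by (intro continuous_intros C01_D(1)[OF f] continuous_on_compose2[OF clamp01_props(3)[of UNIV]]) auto
    then show ?thesis unfolding g_def by (rule continuous_on_eq) simp
  qed
  have g01: "g x \<in> {0..1}" if "x \<in> {0..1}" for x
  proof -
    have "(1 - w x) *\<^sub>R f x + w x *\<^sub>R k x \<in> {0..1}"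
      using convexD[OF convex_real_interval(5)[of 0 1] C01_D(2)[OF f that] k01[of x], of "1 - w x" "w x"] w01[of x]
      by simp
    moreover have "(1 - w x) *\<^sub>R f x + w x *\<^sub>R k x = g x"
      using that by (simp add: g_def algebra_simps)
    ultimately show ?thesis by simp
  qed
  have gC: "g \<in> mspace C01"
    using g_cont g01 restrict_extensional by (simp add: mspace_C01 image_subset_iff) (simp add: g_def)
  have "splits g a b \<delta>"
  proof -
    have "g ` {c..d} \<subseteq> {m}"
    proof safe
      fix x assume x: "x \<in> {c..d}"
      then have "x \<in> {0..1}" "\<bar>x - p\<bar> \<le> \<eta>" using c d uv ab by auto
      then show "g x = m" using w_near k_lo x by (simp add: g_def)
    qed
    moreover have "g ` {c'..d'} \<subseteq> {m'}"
    proof safe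
      fix x assume x: "x \<in> {c'..d'}"
      then have "x \<in> {0..1}" "\<bar>x - p\<bar> \<le> \<eta>" using c d c' d' uv ab by auto
      then show "g x = m'" using w_near k_hi x by (simp add: g_def)
    qed
    ultimately have "g ` {c..d} \<subseteq> {c<..<d}" "g ` {c'..d'} \<subseteq> {c'<..<d'}" using m by auto
    then show ?thesis
      unfolding splits_def using c d c' d' uv \<open>v - u \<le> \<eta>\<close> \<eta>(4)
      by (intro exI[of _ c] exI[of _ d] exI[of _ c'] exI[of _ d']) auto
  qed
  moreover have "mdist C01 f g \<le> r"
    unfolding mdist_C01[OF f gC]
  proof (intro cSUP_least)
    fix x :: real assume x: "x \<in> {0..1}"
    have eq: "\<bar>f x - g x\<bar> = w x * \<bar>k x - f x\<bar>"
      using x w01[of x] by (simp add: g_def abs_mult)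
    show "\<bar>f x - g x\<bar> \<le> r"
    proof (cases "\<bar>x - p\<bar> < 2 * \<eta>")
      case True
      then have "\<bar>f x - p\<bar> < r / 2" using h(2)[OF x] \<eta>(2) p(2) by (auto simp: dist_real_def)
      moreover have "\<bar>k x - p\<bar> < r / 2"
      proof -
        have "p - \<eta> < k x" "k x < p + \<eta>" using k_range[of x] m c d c' d' uv by auto
        then show ?thesis using \<eta>(3) by linarith
      qed
      ultimately have "\<bar>k x - f x\<bar> \<le> r" by linarith
      then show ?thesis unfolding eq using w01[of x] mult_left_le_one_le[of "\<bar>k x - f x\<bar>" "w x"] by simp
    next
      case False
      then show ?thesis unfolding eq using w_far[of x] \<open>r > 0\<close> by simp
    qed
  qed auto
  ultimately show ?thesis using that gC by blast
qed

lemma dense_splitting_maps: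
  assumes "\<delta> > 0"
  shows "C01.mtopology closure_of (splitting_maps a b \<delta>) = mspace C01"
  unfolding C01.metric_closure_of_alt
proof (intro equalityI subsetI CollectI conjI allI impI)
  fix f :: "real \<Rightarrow> real" and r :: real assume f: "f \<in> mspace C01" and "r > 0"
  show "\<exists>g\<in>splitting_maps a b \<delta>. g \<in> C01.mcball f r"
  proof (cases "invariant_interval f a b")
    case True
    from splitting_perturbation[OF f True assms \<open>r > 0\<close>] f show ?thesis
      by (auto simp: splitting_maps_def C01.in_mcball)
  next
    case False
    then show ?thesis using f \<open>r > 0\<close> by (intro bexI[of _ f]) (auto simp: splitting_maps_def)
  qed
qed auto

lemma mcomplete_C01: "C01.mcomplete"
proof -
  interpret S: Submetric UNIV dist "{0..1::real}" by unfold_locales simp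
  have "S.sub.mcomplete" by (rule S.compactin_imp_mcomplete) simp
  from S.sub.mcomplete_cfunspace[OF this, of "top_of_set {0..1}"] show ?thesis
    by (simp add: mcomplete_of_def C01_def S.sub.Self_def submetric_def)
qed

theorem theorem5:
  fixes \<Psi> :: "nat \<Rightarrow> real \<Rightarrow> real"
  assumes "range \<Psi> \<subseteq> mspace C01"
    and "mtopology_of C01 closure_of range \<Psi> = mspace C01"
  shows "typically (mtopology_of C01)
           (\<lambda>f. \<exists>F. uncountable F \<and> F \<subseteq> {x \<in> {0..1}. f x = x} \<and>
                    (\<forall>x\<in>F. pseudo_physical \<Psi> f (dirac x)))"
proof -
  have top: "mtopology_of C01 = C01.mtopology" by (simp add: mtopology_of_def)
  define \<G> where "\<G> = (\<lambda>(a, b, n). splitting_maps a b (1 / Suc n)) ` (\<rat> \<times> \<rat> \<times> (UNIV :: nat set))"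
  have cnt: "countable \<G>" by (auto simp: \<G>_def countable_rat)
  have open_dense: "openin C01.mtopology T \<and> C01.mtopology closure_of T = mspace C01" if "T \<in> \<G>" for T
    using that openin_splitting_maps dense_splitting_maps by (force simp: \<G>_def)
  have "gdelta_in C01.mtopology (\<Inter>\<G>)"
    using cnt open_dense by (intro gdelta_in_Inter open_imp_gdelta_in) (auto simp: \<G>_def)
  moreover have "C01.mtopology closure_of \<Inter>\<G> = mspace C01"
    by (rule C01.metric_Baire_category[OF mcomplete_C01 cnt open_dense])
  moreover have "\<exists>F. uncountable F \<and> F \<subseteq> {x \<in> {0..1}. f x = x} \<and>
      (\<forall>x\<in>F. pseudo_physical \<Psi> f (dirac x))" if "f \<in> \<Inter>\<G>" for f
  proof (intro exI conjI)
    have mem: "f \<in> splitting_maps a b (1 / Suc n)" if "a \<in> \<rat>" "b \<in> \<rat>" for a b n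
      using \<open>f \<in> \<Inter>\<G>\<close> that by (force simp: \<G>_def)
    then have f: "f \<in> mspace C01" using Rats_0 by (force simp: splitting_maps_def)
    show "uncountable (shrinking_points f)"
      using mem by (intro uncountable_shrinking_points[OF f]) (auto simp: splitting_maps_def)
    show "shrinking_points f \<subseteq> {x \<in> {0..1}. f x = x}"
      using shrinking_point_fixed by blast
    show "\<forall>x\<in>shrinking_points f. pseudo_physical \<Psi> f (dirac x)"
      using dirac_pseudo_physical[OF assms(1) f] by blast
  qed
  ultimately show ?thesis
    unfolding typically_def top by auto
qed

end
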